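(* Let $(V,E)$ be a finite oriented graph that is bipartite, corresponding to a partition $\{V_1,V_2\}$ of $V$. Let $U_{\rm even}(E)$ be the set of unbranched subgraphs $F$ of $(V,E)$ such that $|F_j|$ is even for each connected component $F_j$ of $F$, and define $$p_{\rm unbranched\,even}(z)=\sum_{F\in U_{\rm even}(E)}z^{|F|}.$$ Assume that the nonempty connected unbranched subgraphs of $(V,E)$ come in pairs $(G,\bar G)$, i.e. there is an involution $G\mapsto\bar G$ on the set of nonempty connected unbranched subgraphs, such that: (i) $G$ and $\bar G$ connect the same vertices, i.e. the set of endpoints of edges of $G$ equals the set of endpoints of edges of $\bar G$; (ii) $G$ and $\bar G$ are either both loops or both not loops; (iii) if $G$ is not a loop, with endpoints $x',x''$ ($x'$ initial, $x''$ final), and $\bar x',\bar x''$ are the endpoints of $\bar G$ ($\bar x'$ initial, $\bar x''$ final), then $x'=\bar x''$ and $x''=\bar x'$. Then the zeros (in $\mathbb{C}$) of the polynomial $p_{\rm unbranched\,even}(z)$ are all purely imaginary.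
   Context: An oriented graph is a pair $(V,E)$ of finite sets with $V\ne\emptyset$, together with two maps $x',x'':E\to V$ such that $x'(e)\ne x''(e)$ for all $e\in E$. Elements of $V$ are vertices; elements $e\in E$ are oriented edges, going from $x'(e)$ to $x''(e)$, and $x'(e),x''(e)$ are the endpoints of $e$. Different edges are allowed to have the same endpoints, with the same or the opposite orientation. $(V,E)$ is bipartite (corresponding to the partition $\{V_1,V_2\}$) if $\{V_1,V_2\}$ is a partition of $V$ into two nonempty sets such that for each $e\in E$ the vertices $x'(e)$ and $x''(e)$ are in different sets of the partition (edges may go from $V_1$ to $V_2$ or from $V_2$ to $V_1$). A subgraph of $(V,E)$ is a subset $F\subset E$, and $|F|$ denotes its number of edges. A subgraph $F$ is connected if for each partition $\{F_1,F_2\}$ of $F$ into two nonempty sets there is a vertex $x\in V$ which is an endpoint of both some $e_1\in F_1$ and some $e_2\in F_2$. Every subgraph is in a unique way a union of its (nonempty, connected) connected components $F_j$. A subgraph $F$ is unbranched if for each $x\in V$, $$|\{e\in F: x'(e)=x\}|\le 1\quad\text{and}\quad |\{e\in F: x''(e)=x\}|\le 1.$$ $U(E)$ denotes the set of all unbranched subgraphs; $\emptyset\in U(E)$ and $\emptyset\in U_{\rm even}(E)$. A nonempty connected unbranched subgraph $G$ is a loop if $|\{e\in G:x'(e)=x\}|=|\{e\in G:x''(e)=x\}|$ for each $x\in V$ (so $G$ is a directed cycle). If $G$ is nonempty, connected, unbranched and not a loop, then it is a directed path; its endpoints $x',x''$ are the distinct initial vertex $x'$ (having an outgoing but no ingoing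 edge of $G$) and final vertex $x''$ (having an ingoing but no outgoing edge of $G$). *)

theory Defs
  imports
    Complex_Main
    "HOL-Computational_Algebra.Polynomial"
    "Graph_Theory.Digraph"
begin

text \<open>
  An oriented graph \<open>(V, E)\<close> is a digraph \<open>D\<close> with \<open>V = verts D\<close>, \<open>E = arcs D\<close>,
  \<open>x'(e) = tail D e\<close> and \<open>x''(e) = head D e\<close>. Parallel and opposite arcs are allowed.
\<close>

locale oriented_graph = fin_digraph D + loopfree_digraph D
  for D :: "('a, 'b) pre_digraph" +
  assumes verts_nonempty: "verts D \<noteq> {}"

definition endpoints :: "('a, 'b) pre_digraph \<Rightarrow> 'b \<Rightarrow> 'a set" where
  "endpoints D e = {tail D e, head D e}"

definition bipartite_wrt :: "('a, 'b) pre_digraph \<Rightarrow> 'a set \<Rightarrow> 'a set \<Rightarrow> bool" where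
  "bipartite_wrt D V1 V2 \<longleftrightarrow>
     V1 \<noteq> {} \<and> V2 \<noteq> {} \<and> V1 \<inter> V2 = {} \<and> V1 \<union> V2 = verts D \<and>
     (\<forall>e \<in> arcs D. (tail D e \<in> V1 \<and> head D e \<in> V2) \<or> (tail D e \<in> V2 \<and> head D e \<in> V1))"

text \<open>
  A subgraph is a set of arcs. The empty subgraph counts as connected here; nonemptiness is
  required separately where it is needed.
\<close>

definition connected_subgraph :: "('a, 'b) pre_digraph \<Rightarrow> 'b set \<Rightarrow> bool" where
  "connected_subgraph D F \<longleftrightarrow> F \<subseteq> arcs D \<and>
     (\<forall>F1 F2. F1 \<noteq> {} \<and> F2 \<noteq> {} \<and> F1 \<inter> F2 = {} \<and> F1 \<union> F2 = F \<longrightarrow>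
        (\<exists>x \<in> verts D. \<exists>e1 \<in> F1. \<exists>e2 \<in> F2. x \<in> endpoints D e1 \<and> x \<in> endpoints D e2))"

text \<open>The connected components are the maximal nonempty connected subgraphs.\<close>

definition components :: "('a, 'b) pre_digraph \<Rightarrow> 'b set \<Rightarrow> 'b set set" where
  "components D F = {C. C \<subseteq> F \<and> C \<noteq> {} \<and> connected_subgraph D C \<and>
     (\<forall>C'. C \<subseteq> C' \<and> C' \<subseteq> F \<and> connected_subgraph D C' \<longrightarrow> C' = C)}"

definition unbranched :: "('a, 'b) pre_digraph \<Rightarrow> 'b set \<Rightarrow> bool" where
  "unbranched D F \<longleftrightarrow> F \<subseteq> arcs D \<and>
     (\<forall>x \<in> verts D. card {e \<in> F. tail D e = x} \<le> 1 \<and> card {e \<in> F. head D e = x} \<le> 1)"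

definition U_even :: "('a, 'b) pre_digraph \<Rightarrow> 'b set set" where
  "U_even D = {F. unbranched D F \<and> (\<forall>C \<in> components D F. even (card C))}"

definition p_unbranched_even :: "('a, 'b) pre_digraph \<Rightarrow> complex poly" where
  "p_unbranched_even D = (\<Sum>F \<in> U_even D. monom 1 (card F))"

definition conn_unbranched :: "('a, 'b) pre_digraph \<Rightarrow> 'b set set" where
  "conn_unbranched D = {G. G \<noteq> {} \<and> connected_subgraph D G \<and> unbranched D G}"

text \<open>A loop is a directed cycle (not an arc with equal ends, as in the digraph library).\<close>

definition loop_subgraph :: "('a, 'b) pre_digraph \<Rightarrow> 'b set \<Rightarrow> bool" where
  "loop_subgraph D G \<longleftrightarrow> G \<in> conn_unbranched D \<and>
     (\<forall>x \<in> verts D. card {e \<in> G. tail D e = x} = card {e \<in> G. head D e = x})"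

definition initial_vertex :: "('a, 'b) pre_digraph \<Rightarrow> 'b set \<Rightarrow> 'a \<Rightarrow> bool" where
  "initial_vertex D G x \<longleftrightarrow> x \<in> verts D \<and> (\<exists>e \<in> G. tail D e = x) \<and> \<not> (\<exists>e \<in> G. head D e = x)"

definition final_vertex :: "('a, 'b) pre_digraph \<Rightarrow> 'b set \<Rightarrow> 'a \<Rightarrow> bool" where
  "final_vertex D G x \<longleftrightarrow> x \<in> verts D \<and> (\<exists>e \<in> G. head D e = x) \<and> \<not> (\<exists>e \<in> G. tail D e = x)"

end

theory Submission
  imports Defs
begin

text \<open>
  Give each arc from \<open>V1\<close> to \<open>V2\<close> the weight \<open>- \<i> z\<close> and every other arc the weight \<open>\<i> z\<close>, and
  sum the weights of all unbranched subgraphs. A component of even length has equally many arcs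
  in both directions, so it contributes \<open>z\<close> to the power of its length. Replacing \<open>G\<close> by its
  partner exchanges the numbers of arcs in the two directions, which changes the sign of the weight
  if \<open>G\<close> has odd length; hence the subgraphs with an odd component cancel, and the sum is
  \<open>p_unbranched_even(z)\<close>. On the other hand, a subgraph of a bipartite graph is unbranched iff its
  arcs from \<open>V1\<close> to \<open>V2\<close> and its arcs from \<open>V2\<close> to \<open>V1\<close> both form matchings. So the sum is the
  product of two matching polynomials, evaluated at \<open>- \<i> z\<close> and \<open>\<i> z\<close>, and these have only real
  zeros by Heilmann and Lieb.
\<close>

section \<open>Matching polynomials\<close>

definition matchings :: "('e \<Rightarrow> 'v set) \<Rightarrow> 'e set \<Rightarrow> 'e set set" where
  "matchings ends A = {M. M \<subseteq> A \<and> (\<forall>e\<in>M. \<forall>f\<in>M. e \<noteq> f \<longrightarrow> ends e \<inter> ends f = {})}"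

definition matching_sum :: "('e \<Rightarrow> 'v set) \<Rightarrow> complex \<Rightarrow> 'e set \<Rightarrow> complex" where
  "matching_sum ends z A = (\<Sum>M\<in>matchings ends A. z ^ card M)"

lemma finite_matchings: "finite A \<Longrightarrow> finite (matchings ends A)"
  unfolding matchings_def by (rule finite_subset[of _ "Pow A"]) auto

lemma matching_sum_empty [simp]: "matching_sum ends z {} = 1"
proof -
  have "matchings ends {} = {{}}"
    by (auto simp: matchings_def)
  then show ?thesis
    by (simp add: matching_sum_def)
qed

text \<open>A matching either avoids \<open>v\<close> or has exactly one edge \<open>e\<close> at
  \<open>v\<close>, whose removal leaves a matching of edges disjoint from \<open>e\<close>. This is
  the vertex recursion of the matching polynomial.\<close>

lemma matching_sum_delete_vertex:
  assumes "finite A"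
  shows "matching_sum ends z A = matching_sum ends z {f\<in>A. v \<notin> ends f} +
    z * (\<Sum>e\<in>{e\<in>A. v \<in> ends e}. matching_sum ends z {f\<in>A. ends f \<inter> ends e = {}})"
proof -
  define S where "S = {e\<in>A. v \<in> ends e}"
  define N where "N = (\<lambda>e. matchings ends {f\<in>A. ends f \<inter> ends e = {}})"
  have split: "matchings ends A =
      matchings ends {f\<in>A. v \<notin> ends f} \<union> (\<Union>e\<in>S. insert e ` N e)"
  proof (intro equalityI subsetI)
    fix M assume M: "M \<in> matchings ends A"
    show "M \<in> matchings ends {f\<in>A. v \<notin> ends f} \<union> (\<Union>e\<in>S. insert e ` N e)"
    proof (cases "\<exists>e\<in>M. v \<in> ends e")
      case True
      then obtain e where e: "e \<in> M" "v \<in> ends e" by blast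
      have "e \<in> S" "M - {e} \<in> N e" "M = insert e (M - {e})"
        using M e by (auto simp: matchings_def S_def N_def)
      then show ?thesis by blast
    next
      case False
      then show ?thesis using M by (auto simp: matchings_def)
    qed
  next
    fix M assume "M \<in> matchings ends {f\<in>A. v \<notin> ends f} \<union> (\<Union>e\<in>S. insert e ` N e)"
    then show "M \<in> matchings ends A"
    proof
      assume "M \<in> matchings ends {f\<in>A. v \<notin> ends f}"
      then show ?thesis by (auto simp: matchings_def)
    next
      assume "M \<in> (\<Union>e\<in>S. insert e ` N e)"
      then obtain e M' where "e \<in> S" "M' \<in> N e" "M = insert e M'" by blast
      then show ?thesis
        unfolding matchings_def S_def N_def by blast
    qed
  qed
  have fin: "finite S" "\<And>e. finite (N e)"
    using assms by (auto simp: S_def N_def intro!: finite_matchings)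
  have fresh: "e \<notin> M" if "e \<in> S" "M \<in> N e" for e M
    using that by (auto simp: S_def N_def matchings_def)
  have inj: "inj_on (insert e) (N e)" if "e \<in> S" for e
    using fresh[OF that] by (auto intro!: inj_onI simp: insert_ident)
  have block: "(\<Sum>M\<in>insert e ` N e. z ^ card M) =
      z * matching_sum ends z {f\<in>A. ends f \<inter> ends e = {}}" if "e \<in> S" for e
  proof -
    have "card (insert e M) = Suc (card M)" if "M \<in> N e" for M
    proof -
      have "finite M"
        using that assms by (auto simp: N_def matchings_def intro: finite_subset)
      then show ?thesis
        using fresh[OF \<open>e \<in> S\<close> that] by simp
    qed
    then show ?thesis
      unfolding sum.reindex[OF inj[OF that]]
      by (simp add: matching_sum_def N_def sum_distrib_left)
  qed
  have "matching_sum ends z A = matching_sum ends z {f\<in>A. v \<notin> ends f} +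
      (\<Sum>M\<in>(\<Union>e\<in>S. insert e ` N e). z ^ card M)"
    unfolding matching_sum_def split
  proof (rule sum.union_disjoint)
    show "finite (matchings ends {f\<in>A. v \<notin> ends f})"
      using assms by (intro finite_matchings) simp
    show "finite (\<Union>e\<in>S. insert e ` N e)"
      using fin by simp
    show "matchings ends {f\<in>A. v \<notin> ends f} \<inter> (\<Union>e\<in>S. insert e ` N e) = {}"
      by (auto simp: matchings_def S_def)
  qed
  also have "(\<Sum>M\<in>(\<Union>e\<in>S. insert e ` N e). z ^ card M) =
      (\<Sum>e\<in>S. \<Sum>M\<in>insert e ` N e. z ^ card M)"
  proof (rule sum.UNION_disjoint)
    \<comment> \<open>Both edges contain \<open>v\<close>, and every edge of \<open>M\<close> is
      disjoint from \<open>e\<close>, so \<open>f\<close> cannot lie in \<open>M\<close>.\<close>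
    have "e = f" if "e \<in> S" "f \<in> S" "insert e M = insert f M'" "M \<in> N e" for e f M M'
      using that by (fastforce simp: S_def N_def matchings_def)
    then show "\<forall>e\<in>S. \<forall>f\<in>S. e \<noteq> f \<longrightarrow> insert e ` N e \<inter> insert f ` N f = {}"
      by blast
  qed (use fin in auto)
  also have "\<dots> = z * (\<Sum>e\<in>S. matching_sum ends z {f\<in>A. ends f \<inter> ends e = {}})"
    by (simp add: block sum_distrib_left)
  finally show ?thesis
    by (simp add: S_def)
qed

section \<open>Real-rootedness by a half-plane argument\<close>

lemma Re_inverse_pos:
  fixes w :: complex
  assumes "0 < Re w"
  shows "0 < Re (inverse w)"
proof -
  have "0 < (Re w)\<^sup>2 + (Im w)\<^sup>2"
    using assms by (intro add_pos_nonneg) auto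
  then show ?thesis
    using assms by simp
qed

text \<open>
  The ratios \<open>r(A, v) = M(A) / (w M(A - v))\<close> satisfy
  \<open>r(A, v) = 1/w + (\<Sum> 1 / r(A - v, u))\<close>, summed over the edges \<open>vu\<close>,
  so they stay in the right half-plane.
\<close>
lemma matching_sum_ratio:
  assumes "finite A" and "\<And>e. e \<in> A \<Longrightarrow> card (ends e) = 2" and w: "0 < Re w"
  shows "matching_sum ends (w\<^sup>2) A \<noteq> 0 \<and>
    (\<forall>v. 0 < Re (matching_sum ends (w\<^sup>2) A / (w * matching_sum ends (w\<^sup>2) {f\<in>A. v \<notin> ends f})))"
  using assms(1,2)
proof (induction A rule: finite_psubset_induct)
  case (psubset A)
  let ?M = "matching_sum ends (w\<^sup>2)"
  have w0: "w \<noteq> 0" using w by auto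
  have step: "?M A \<noteq> 0 \<and> 0 < Re (?M A / (w * ?M {f\<in>A. v \<notin> ends f}))"
    if v: "\<exists>e\<in>A. v \<in> ends e" for v
  proof -
    define B where "B = {f\<in>A. v \<notin> ends f}"
    have "B \<subset> A" using v by (auto simp: B_def)
    then have B0: "?M B \<noteq> 0"
      and B: "\<And>u. 0 < Re (?M B / (w * ?M {f\<in>B. u \<notin> ends f}))"
      using psubset.IH[of B] psubset.prems by auto
    have "?M A / (w * ?M B) =
        inverse w + (\<Sum>e\<in>{e\<in>A. v \<in> ends e}. w * ?M {f\<in>A. ends f \<inter> ends e = {}} / ?M B)"
      using B0 w0 matching_sum_delete_vertex[OF \<open>finite A\<close>, of ends "w\<^sup>2" v]
      by (simp add: B_def[symmetric] field_simps power2_eq_square sum_divide_distrib[symmetric]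
          sum_distrib_left)
    moreover have "0 < Re (w * ?M {f\<in>A. ends f \<inter> ends e = {}} / ?M B)"
      if e: "e \<in> {e\<in>A. v \<in> ends e}" for e
    proof -
      have "card (ends e) = 2" "v \<in> ends e"
        using e psubset.prems by auto
      then obtain u where "ends e = {v, u}"
        by (metis card_2_iff doubleton_eq_iff insertE singletonD)
      \<comment> \<open>The edges disjoint from \<open>e\<close> are those of \<open>B\<close>
        avoiding \<open>u\<close>, so the summand is the reciprocal of a smaller ratio, controlled
        by induction.\<close>
      then have "{f\<in>A. ends f \<inter> ends e = {}} = {f\<in>B. u \<notin> ends f}"
        by (auto simp: B_def)
      then have "w * ?M {f\<in>A. ends f \<inter> ends e = {}} / ?M B =
          inverse (?M B / (w * ?M {f\<in>B. u \<notin> ends f}))"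
        by simp
      then show ?thesis
        using Re_inverse_pos[OF B] by metis
    qed
    ultimately have "0 < Re (?M A / (w * ?M B))"
      using Re_inverse_pos[OF w]
      by (simp only: plus_complex.sel Re_sum)
        (intro add_pos_nonneg sum_nonneg less_imp_le)
    \<comment> \<open>The positive real part also gives \<open>?M A \<noteq> 0\<close>, since a zero
      numerator would make the ratio zero.\<close>
    then show ?thesis
      unfolding B_def by auto
  qed
  show ?case
  proof (intro conjI allI)
    show M0: "?M A \<noteq> 0"
    proof (cases "A = {}")
      case False
      then obtain e where "e \<in> A" by blast
      moreover from this obtain v where "v \<in> ends e"
        using psubset.prems by (metis card.empty equals0I zero_neq_numeral)
      ultimately show ?thesis using step by blast
    qed simp
    fix v
    show "0 < Re (?M A / (w * ?M {f\<in>A. v \<notin> ends f}))"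
    proof (cases "\<exists>e\<in>A. v \<in> ends e")
      case False
      \<comment> \<open>Deleting a vertex that no edge covers changes nothing, so the ratio is just
        \<open>1/w\<close>.\<close>
      then have "{f\<in>A. v \<notin> ends f} = A" by blast
      then have "?M A / (w * ?M {f\<in>A. v \<notin> ends f}) = inverse w"
        using M0 by (simp add: field_simps)
      then show ?thesis using Re_inverse_pos[OF w] by simp
    qed (use step in blast)
  qed
qed

text \<open>Every nonreal \<open>z\<close> is the square of some \<open>w\<close> in the open right
  half-plane, where \<open>matching_sum_ratio\<close> excludes zeros. The principal root serves as
  \<open>w\<close>: its real part is nonnegative, and vanishes only if \<open>z\<close> is
  real.\<close>

theorem Heilmann_Lieb:
  assumes "finite A" and "\<And>e. e \<in> A \<Longrightarrow> card (ends e) = 2"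
    and "matching_sum ends z A = 0"
  shows "z \<in> \<real>"
proof (rule ccontr)
  assume "z \<notin> \<real>"
  define w where "w = csqrt z"
  have z: "z = w\<^sup>2" by (simp add: w_def)
  have "Re w \<noteq> 0"
  proof
    assume "Re w = 0"
    then have "Im (w\<^sup>2) = 0" by (simp add: power2_eq_square)
    then show False
      using \<open>z \<notin> \<real>\<close> z by (simp add: complex_is_Real_iff)
  qed
  moreover have "0 \<le> Re w"
    using csqrt_principal[of z] by (auto simp: w_def)
  ultimately show False
    using matching_sum_ratio[of A ends w] assms z by force
qed

section \<open>Connected components\<close>

definition verts_of :: "('a, 'b) pre_digraph \<Rightarrow> 'b set \<Rightarrow> 'a set" where
  "verts_of D G = (\<Union>e\<in>G. endpoints D e)"

lemma verts_of_alt: "verts_of D G = tail D ` G \<union> head D ` G"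
  by (auto simp: verts_of_def endpoints_def)

lemma verts_of_mono: "G \<subseteq> H \<Longrightarrow> verts_of D G \<subseteq> verts_of D H"
  by (auto simp: verts_of_def)

lemma verts_of_disjointD: "verts_of D G \<inter> verts_of D H = {} \<Longrightarrow> G \<inter> H = {}"
  by (auto simp: verts_of_def endpoints_def)

text \<open>Disjointness of vertex sets is stronger than disjointness of arc sets; it is what
  singles out the decomposition into components (\<open>components_eqI\<close>).\<close>

definition verts_disjoint :: "('a, 'b) pre_digraph \<Rightarrow> 'b set set \<Rightarrow> bool" where
  "verts_disjoint D \<C> \<longleftrightarrow>
     (\<forall>C\<in>\<C>. \<forall>C'\<in>\<C>. C \<noteq> C' \<longrightarrow> verts_of D C \<inter> verts_of D C' = {})"

context fin_digraph
begin

text \<open>Endpoints of arcs are vertices, so the common vertex can be expressed by intersecting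
  vertex sets, and connectedness becomes set algebra.\<close>

lemma connected_subgraph_alt:
  "connected_subgraph G F \<longleftrightarrow> F \<subseteq> arcs G \<and>
     (\<forall>F1 F2. F1 \<noteq> {} \<longrightarrow> F2 \<noteq> {} \<longrightarrow> F1 \<inter> F2 = {} \<longrightarrow> F1 \<union> F2 = F \<longrightarrow>
        verts_of G F1 \<inter> verts_of G F2 \<noteq> {})"
proof -
  have "(\<exists>x\<in>verts G. \<exists>e1\<in>F1. \<exists>e2\<in>F2. x \<in> endpoints G e1 \<and> x \<in> endpoints G e2) \<longleftrightarrow>
      verts_of G F1 \<inter> verts_of G F2 \<noteq> {}" if "F1 \<union> F2 \<subseteq> arcs G" for F1 F2
  proof -
    have "verts_of G F1 \<subseteq> verts G"
      using that by (auto simp: verts_of_alt)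
    then show ?thesis
      by (auto simp: verts_of_def)
  qed
  note meet = this
  have "(F1 \<noteq> {} \<and> F2 \<noteq> {} \<and> F1 \<inter> F2 = {} \<and> F1 \<union> F2 = F \<longrightarrow>
        (\<exists>x\<in>verts G. \<exists>e1\<in>F1. \<exists>e2\<in>F2. x \<in> endpoints G e1 \<and> x \<in> endpoints G e2)) \<longleftrightarrow>
      (F1 \<noteq> {} \<longrightarrow> F2 \<noteq> {} \<longrightarrow> F1 \<inter> F2 = {} \<longrightarrow> F1 \<union> F2 = F \<longrightarrow>
        verts_of G F1 \<inter> verts_of G F2 \<noteq> {})" if "F \<subseteq> arcs G" for F1 F2
  proof (cases "F1 \<union> F2 = F")
    case True
    then show ?thesis
      using meet[of F1 F2] that by (simp only: simp_thms imp_conjL)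
  qed simp
  then show ?thesis
    unfolding connected_subgraph_def by (simp only: cong: conj_cong)
qed

lemma connected_subgraph_singleton:
  assumes "e \<in> arcs G"
  shows "connected_subgraph G {e}"
proof -
  have False if "F1 \<noteq> {}" "F2 \<noteq> {}" "F1 \<inter> F2 = {}" "F1 \<union> F2 = {e}" for F1 F2
    using that by (metis Un_singleton_iff inf.idem)
  then show ?thesis
    unfolding connected_subgraph_alt using assms by blast
qed

text \<open>If \<open>C \<union> C'\<close> split into two vertex-disjoint parts, each of
  \<open>C\<close> and \<open>C'\<close> would lie inside one part. They cannot lie in the same one,
  as the other would be empty; opposite parts contradict the shared vertex.\<close>

lemma connected_subgraph_Un:
  assumes C: "connected_subgraph G C" and C': "connected_subgraph G C'"
    and meet: "verts_of G C \<inter> verts_of G C' \<noteq> {}"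
  shows "connected_subgraph G (C \<union> C')"
  unfolding connected_subgraph_alt
proof (intro conjI allI impI)
  show "C \<union> C' \<subseteq> arcs G"
    using C C' by (simp add: connected_subgraph_def)
  fix F1 F2
  assume F: "F1 \<noteq> {}" "F2 \<noteq> {}" "F1 \<inter> F2 = {}" "F1 \<union> F2 = C \<union> C'"
  show "verts_of G F1 \<inter> verts_of G F2 \<noteq> {}"
  proof
    assume disj: "verts_of G F1 \<inter> verts_of G F2 = {}"
    have side: "K \<subseteq> F1 \<or> K \<subseteq> F2" if K: "connected_subgraph G K" "K \<subseteq> F1 \<union> F2" for K
    proof (rule ccontr)
      assume "\<not> ?thesis"
      then have parts: "K \<inter> F1 \<noteq> {}" "K \<inter> F2 \<noteq> {}"
          "(K \<inter> F1) \<inter> (K \<inter> F2) = {}" "(K \<inter> F1) \<union> (K \<inter> F2) = K"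
        using K F by auto
      have "verts_of G (K \<inter> F1) \<inter> verts_of G (K \<inter> F2) \<noteq> {}"
        using K(1)[unfolded connected_subgraph_alt, THEN conjunct2, rule_format, OF parts] .
      then show False
        using disj verts_of_mono[of "K \<inter> F1" F1 G] verts_of_mono[of "K \<inter> F2" F2 G] by blast
    qed
    have "C \<subseteq> F1 \<and> C' \<subseteq> F2 \<or> C \<subseteq> F2 \<and> C' \<subseteq> F1"
      using side[OF C] side[OF C'] F by blast
    then have "verts_of G C \<inter> verts_of G C' \<subseteq> verts_of G F1 \<inter> verts_of G F2"
      using verts_of_mono[of C F1 G] verts_of_mono[of C F2 G]
        verts_of_mono[of C' F1 G] verts_of_mono[of C' F2 G] by (elim disjE) auto
    then show False
      using meet disj by simp
  qed
qed

lemma components_connected: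
  assumes "C \<in> components G F"
  shows "C \<subseteq> F" "C \<noteq> {}" "connected_subgraph G C"
  using assms by (auto simp: components_def)

lemma components_maximal:
  "C \<in> components G F \<Longrightarrow> C \<subseteq> C' \<Longrightarrow> C' \<subseteq> F \<Longrightarrow> connected_subgraph G C' \<Longrightarrow> C' = C"
  by (simp add: components_def)

text \<open>Two components sharing a vertex have a connected union, which by maximality equals
  both.\<close>

lemma verts_disjoint_components: "verts_disjoint G (components G F)"
  unfolding verts_disjoint_def
proof (intro ballI impI)
  fix C C' assume C: "C \<in> components G F" "C' \<in> components G F" and ne: "C \<noteq> C'"
  show "verts_of G C \<inter> verts_of G C' = {}"
  proof (rule ccontr)
    assume "\<not> ?thesis"
    then have "connected_subgraph G (C \<union> C')"
      using C by (intro connected_subgraph_Un components_connected(3))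
    moreover have "C \<union> C' \<subseteq> F"
      using C[THEN components_connected(1)] by simp
    ultimately have "C \<union> C' = C" "C \<union> C' = C'"
      using C[THEN components_maximal, of "C \<union> C'"] by auto
    then show False using ne by simp
  qed
qed

lemma Union_components:
  assumes "F \<subseteq> arcs G"
  shows "\<Union> (components G F) = F"
proof (intro equalityI subsetI)
  fix e assume e: "e \<in> F"
  let ?S = "{C. e \<in> C \<and> C \<subseteq> F \<and> connected_subgraph G C}"
  have "finite ?S"
    using finite_subset[OF assms finite_arcs] by (auto intro: finite_subset[of _ "Pow F"])
  moreover have "{e} \<in> ?S"
    using e assms connected_subgraph_singleton by blast
  ultimately obtain C where C: "C \<in> ?S" and max: "\<forall>C'\<in>?S. C \<subseteq> C' \<longrightarrow> C = C'"
    using finite_has_maximal2[of ?S "{e}"] by auto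
  \<comment> \<open>A connected subgraph larger than \<open>C\<close> still contains
    \<open>e\<close>, so maximality within \<open>?S\<close> is maximality among all connected
    subgraphs of \<open>F\<close>.\<close>
  have "C' = C" if "C \<subseteq> C'" "C' \<subseteq> F" "connected_subgraph G C'" for C'
    using max that C by (metis (mono_tags, lifting) mem_Collect_eq subsetD)
  then have "C \<in> components G F"
    unfolding components_def using C by auto
  then show "e \<in> \<Union> (components G F)"
    using C by blast
qed (auto dest: components_connected(1))

text \<open>A connected subgraph of the union that meets \<open>K\<close> cannot leave
  \<open>K\<close>: its part outside would share a vertex with \<open>K\<close>, although that part
  lies in other members of the family. This identifies the components after one of them is
  exchanged.\<close>

lemma components_eqI:
  assumes "\<And>C. C \<in> \<C> \<Longrightarrow> C \<noteq> {} \<and> connected_subgraph G C" and disj: "verts_disjoint G \<C>"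
  shows "components G (\<Union> \<C>) = \<C>"
proof -
  have within: "C \<subseteq> K"
    if C: "connected_subgraph G C" "C \<subseteq> \<Union> \<C>" and K: "K \<in> \<C>" "C \<inter> K \<noteq> {}" for C K
  proof (rule ccontr)
    assume "\<not> C \<subseteq> K"
    then have "verts_of G (C \<inter> K) \<inter> verts_of G (C - K) \<noteq> {}"
      using C(1) K(2) unfolding connected_subgraph_alt
      by (metis Diff_eq_empty_iff Int_Diff_disjoint Int_Diff_Un)
    then obtain x f where f: "x \<in> verts_of G K" "f \<in> C - K" "x \<in> endpoints G f"
      unfolding verts_of_def by blast
    then obtain K' where "K' \<in> \<C>" "f \<in> K'"
      using C(2) by blast
    moreover from this have "x \<in> verts_of G K'"
      using f by (auto simp: verts_of_def)
    ultimately show False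
      using disj f K(1) unfolding verts_disjoint_def by blast
  qed
  show ?thesis
  proof (intro equalityI subsetI)
    fix C assume C: "C \<in> components G (\<Union> \<C>)"
    note C' = components_connected[OF C]
    then obtain K where K: "K \<in> \<C>" "C \<inter> K \<noteq> {}"
      by blast
    then have "C \<subseteq> K"
      using within C' by simp
    then have "K = C"
      using components_maximal[OF C] K assms(1) by blast
    then show "C \<in> \<C>"
      using K by simp
  next
    fix K assume "K \<in> \<C>"
    then show "K \<in> components G (\<Union> \<C>)"
      unfolding components_def using within[of _ K] assms(1)[of K] by auto
  qed
qed

section \<open>Unbranched subgraphs\<close>

text \<open>Degree bounds become injectivity, so arcs can be counted through the images of
  \<open>tail\<close> and \<open>head\<close>.\<close>

lemma unbranched_iff_inj:
  "unbranched G F \<longleftrightarrow> F \<subseteq> arcs G \<and> inj_on (tail G) F \<and> inj_on (head G) F"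
proof -
  have "(\<forall>x\<in>verts G. card {e\<in>F. g e = x} \<le> 1) \<longleftrightarrow> inj_on g F"
    if "F \<subseteq> arcs G" "\<And>e. e \<in> arcs G \<Longrightarrow> g e \<in> verts G" for g
  proof -
    have in_verts: "g e \<in> verts G" if "e \<in> F" for e
      using that \<open>F \<subseteq> arcs G\<close> \<open>\<And>e. e \<in> arcs G \<Longrightarrow> g e \<in> verts G\<close> by blast
    have "finite F" using that finite_subset[OF _ finite_arcs] by blast
    then have "card {e\<in>F. g e = x} \<le> 1 \<longleftrightarrow> (\<forall>e\<in>F. \<forall>f\<in>F. g e = x \<longrightarrow> g f = x \<longrightarrow> e = f)" for x
      by (auto simp: card_le_Suc0_iff_eq)
    then have "(\<forall>x\<in>verts G. card {e\<in>F. g e = x} \<le> 1) \<longleftrightarrow>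
        (\<forall>x\<in>verts G. \<forall>e\<in>F. \<forall>f\<in>F. g e = x \<longrightarrow> g f = x \<longrightarrow> e = f)"
      by simp
    also have "\<dots> \<longleftrightarrow> inj_on g F"
    proof
      assume "\<forall>x\<in>verts G. \<forall>e\<in>F. \<forall>f\<in>F. g e = x \<longrightarrow> g f = x \<longrightarrow> e = f"
      then have "e = f" if "e \<in> F" "f \<in> F" "g e = g f" for e f
        using that in_verts[of e] by simp
      then show "inj_on g F" by (rule inj_onI)
    qed (auto dest: inj_onD)
    finally show ?thesis .
  qed
  from this[of "tail G"] this[of "head G"] show ?thesis
    unfolding unbranched_def by auto
qed

lemma unbranched_subset: "unbranched G F \<Longrightarrow> C \<subseteq> F \<Longrightarrow> unbranched G C"
  unfolding unbranched_iff_inj by (auto intro: inj_on_subset)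

lemma unbranched_Un:
  assumes "unbranched G F" "unbranched G H" "verts_of G F \<inter> verts_of G H = {}"
  shows "unbranched G (F \<union> H)"
proof -
  have "inj_on g (F \<union> H)" if "inj_on g F" "inj_on g H" "g = tail G \<or> g = head G" for g
    using that assms(3) unfolding inj_on_Un verts_of_alt by blast
  then show ?thesis
    using assms(1,2) unfolding unbranched_iff_inj by blast
qed

lemma components_conn_unbranched:
  "unbranched G F \<Longrightarrow> C \<in> components G F \<Longrightarrow> C \<in> conn_unbranched G"
  unfolding conn_unbranched_def using components_connected unbranched_subset by blast

section \<open>Loops and paths by counting vertices\<close>

lemma card_verts_of_connected:
  assumes "connected_subgraph G F" "F \<noteq> {}"
  shows "card (verts_of G F) \<le> card F + 1"
proof -
  have fin: "finite F"
    using assms(1) finite_subset[OF _ finite_arcs] unfolding connected_subgraph_def by blast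
  have "\<exists>S\<subseteq>F. card S = Suc k \<and> card (verts_of G S) \<le> Suc k + 1" if "Suc k \<le> card F" for k
    using that
  proof (induction k)
    case 0
    obtain e where "e \<in> F" using assms(2) by blast
    moreover have "card (verts_of G {e}) \<le> 2"
      by (simp add: verts_of_def endpoints_def card_insert_if)
    ultimately show ?case by (intro exI[of _ "{e}"]) auto
  next
    case (Suc k)
    then obtain S where S: "S \<subseteq> F" "card S = Suc k" "card (verts_of G S) \<le> Suc k + 1"
      by auto
    then have "S \<noteq> {}" "F - S \<noteq> {}"
      using Suc.prems by auto
    then have "verts_of G S \<inter> verts_of G (F - S) \<noteq> {}"
      using assms(1) S(1) unfolding connected_subgraph_alt
      by (metis Diff_disjoint Diff_partition)
    then obtain x e where e: "x \<in> verts_of G S" "e \<in> F - S" "x \<in> endpoints G e"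
      unfolding verts_of_def by blast
    have finS: "finite S"
      using fin S(1) finite_subset by blast
    \<comment> \<open>The other end of \<open>e\<close>, the only vertex that can be new.\<close>
    define y where "y = (if x = tail G e then head G e else tail G e)"
    have "verts_of G (insert e S) \<subseteq> insert y (verts_of G S)"
      using e by (auto simp: verts_of_def endpoints_def y_def)
    then have "card (verts_of G (insert e S)) \<le> card (insert y (verts_of G S))"
      using finS by (intro card_mono) (auto simp: verts_of_alt)
    also have "\<dots> \<le> Suc (card (verts_of G S))"
      using finS by (simp add: card_insert_if verts_of_alt)
    finally show ?case
      using S e finS by (intro exI[of _ "insert e S"]) auto
  qed
  \<comment> \<open>The induction counts arcs as \<open>Suc k\<close>, and a subset of
    \<open>F\<close> with \<open>card F\<close> arcs is \<open>F\<close> itself.\<close>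
  from this[of "card F - 1"] show ?thesis
    using fin assms(2) card_subset_eq[OF fin] by (auto simp: card_gt_0_iff)
qed

lemma finite_conn_unbranched: "C \<in> conn_unbranched G \<Longrightarrow> finite C"
  unfolding conn_unbranched_def unbranched_def using finite_subset[OF _ finite_arcs] by blast

text \<open>By injectivity, out- and indegree are the indicator functions of the images of
  \<open>tail\<close> and \<open>head\<close>.\<close>

lemma loop_subgraph_iff:
  assumes C: "C \<in> conn_unbranched G"
  shows "loop_subgraph G C \<longleftrightarrow> tail G ` C = head G ` C"
proof -
  have deg: "card {e\<in>C. g e = x} = (if x \<in> g ` C then 1 else 0)" if "inj_on g C"
    for g :: "'b \<Rightarrow> 'a" and x
  proof (cases "x \<in> g ` C")
    case True
    then obtain e where "e \<in> C" "x = g e" by blast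
    then have "{f\<in>C. g f = x} = {e}" using that by (auto dest: inj_onD)
    then show ?thesis using True by simp
  next
    case False
    then have "{e\<in>C. g e = x} = {}" by blast
    then show ?thesis using False by (metis card.empty)
  qed
  have sub: "C \<subseteq> arcs G" and inj: "inj_on (tail G) C" "inj_on (head G) C"
    using C by (auto simp: conn_unbranched_def unbranched_iff_inj)
  have "tail G ` C \<subseteq> verts G" "head G ` C \<subseteq> verts G"
    using sub by auto
  then have "(\<forall>x\<in>verts G. x \<in> tail G ` C \<longleftrightarrow> x \<in> head G ` C) \<longleftrightarrow> tail G ` C = head G ` C"
    by blast
  moreover have "(if P then 1 else 0 :: nat) = (if Q then 1 else 0) \<longleftrightarrow> (P \<longleftrightarrow> Q)" for P Q
    by simp
  ultimately show ?thesis
    unfolding loop_subgraph_def deg[OF inj(1)] deg[OF inj(2)] using C by simp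
qed

text \<open>Both images have \<open>card C\<close> elements, in a vertex set of size at most
  \<open>card C + 1\<close>. Size \<open>card C\<close> would make both images the whole vertex set,
  hence \<open>C\<close> a loop; so each image misses exactly one vertex.\<close>

lemma path_ends:
  assumes C: "C \<in> conn_unbranched G" and not_loop: "\<not> loop_subgraph G C"
  obtains x y where "initial_vertex G C x" "final_vertex G C y"
    "tail G ` C = verts_of G C - {y}" "head G ` C = verts_of G C - {x}"
proof -
  let ?V = "verts_of G C"
  have sub: "C \<subseteq> arcs G" and inj: "inj_on (tail G) C" "inj_on (head G) C"
    using C by (auto simp: conn_unbranched_def unbranched_iff_inj)
  have fin: "finite ?V"
    using finite_conn_unbranched[OF C] by (simp add: verts_of_alt)
  have TV: "tail G ` C \<subseteq> ?V" and HV: "head G ` C \<subseteq> ?V"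
    by (auto simp: verts_of_alt)
  have cards: "card (tail G ` C) = card C" "card (head G ` C) = card C"
    using inj by (auto intro: card_image)
  have "card ?V \<le> card C + 1"
    using C card_verts_of_connected by (simp add: conn_unbranched_def)
  moreover have "card ?V \<noteq> card C"
    using not_loop C cards fin TV HV card_subset_eq unfolding loop_subgraph_iff[OF C] by metis
  moreover have "card C \<le> card ?V"
    using card_mono[OF fin TV] cards by simp
  ultimately have "card ?V = Suc (card C)" by simp
  then have "card (?V - tail G ` C) = 1" "card (?V - head G ` C) = 1"
    using cards TV HV fin by (simp_all add: card_Diff_subset finite_subset)
  then obtain x y where xy: "?V - tail G ` C = {y}" "?V - head G ` C = {x}"
    by (metis card_1_singletonE)
  then have "x \<in> ?V" "y \<in> ?V" "x \<notin> head G ` C" "y \<notin> tail G ` C" by auto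
  moreover have "?V \<subseteq> verts G"
    using sub by (auto simp: verts_of_alt)
  ultimately have "initial_vertex G C x" "final_vertex G C y"
    unfolding initial_vertex_def final_vertex_def verts_of_alt by blast+
  then show thesis
    using that[of x y] xy TV HV by blast
qed

lemma initial_vertex_image: "initial_vertex G C x \<Longrightarrow> x \<in> verts_of G C - head G ` C"
  by (auto simp: initial_vertex_def verts_of_alt)

lemma final_vertex_image: "final_vertex G C x \<Longrightarrow> x \<in> verts_of G C - tail G ` C"
  by (auto simp: final_vertex_def verts_of_alt)

section \<open>Exchanging a component and the cancellation of odd terms\<close>

text \<open>Since \<open>C'\<close> occupies exactly the vertices of \<open>C\<close>, it stays
  vertex-disjoint from all other components.\<close>

lemma components_replace:
  assumes F: "unbranched G F" and C: "C \<in> components G F"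
    and C': "C' \<in> conn_unbranched G" and same_verts: "verts_of G C' = verts_of G C"
  shows "unbranched G (F - C \<union> C')"
    "components G (F - C \<union> C') = insert C' (components G F - {C})"
    "(F - C) \<inter> C' = {}"
proof -
  have disj: "verts_disjoint G (components G F)"
    by (rule verts_disjoint_components)
  have F_Union: "F = \<Union> (components G F)"
    using F Union_components by (simp add: unbranched_def)
  have apart: "verts_of G C \<inter> verts_of G K = {}" if "K \<in> components G F - {C}" for K
    using that disj C unfolding verts_disjoint_def by blast
  have rest: "\<Union> (components G F - {C}) = F - C"
  proof
    show "\<Union> (components G F - {C}) \<subseteq> F - C"
      using apart[THEN verts_of_disjointD] F_Union by blast
  qed (use F_Union in blast)
  have "verts_of G C \<inter> verts_of G (F - C) = {}"
    unfolding rest[symmetric] using apart unfolding verts_of_def by blast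
  then have verts: "verts_of G (F - C) \<inter> verts_of G C' = {}"
    using same_verts by blast
  then show "unbranched G (F - C \<union> C')"
    using unbranched_Un[of "F - C" C'] unbranched_subset[OF F, of "F - C"] C'
    by (simp add: conn_unbranched_def)
  show "(F - C) \<inter> C' = {}"
    using verts verts_of_disjointD by blast
  have "verts_disjoint G (insert C' (components G F - {C}))"
    using disj apart unfolding verts_disjoint_def same_verts[symmetric] by blast
  then have "components G (\<Union> (insert C' (components G F - {C}))) = insert C' (components G F - {C})"
    using C' components_connected
    by (intro components_eqI) (auto simp: conn_unbranched_def)
  then show "components G (F - C \<union> C') = insert C' (components G F - {C})"
    using rest by (simp add: Un_commute)
qed

lemma finite_unbranched: "finite {F. unbranched G F}"
  by (rule finite_subset[of _ "Pow (arcs G)"]) (auto simp: unbranched_def)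

text \<open>
  Reversing one odd component is a sign-reversing involution. The component is selected
  through its vertex set, which is unaffected by the reversal.
\<close>
lemma odd_terms_cancel:
  fixes g :: "'b \<Rightarrow> complex"
  assumes bar: "\<And>C. C \<in> conn_unbranched G \<Longrightarrow> odd (card C) \<Longrightarrow>
      bar C \<in> conn_unbranched G \<and> bar (bar C) = C \<and> verts_of G (bar C) = verts_of G C \<and>
      card (bar C) = card C \<and> prod g (bar C) = - prod g C"
  shows "(\<Sum>F\<in>{F. unbranched G F} - U_even G. prod g F) = 0"
proof -
  define odds where "odds F = {C \<in> components G F. odd (card C)}" for F
  \<comment> \<open>The choice is made from the set of vertex sets instead of \<open>odds F\<close>,
    so that \<open>F\<close> and \<open>flip F\<close> hand the same argument to
    \<open>SOME\<close>.\<close>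
  define X where "X F = (SOME X. X \<in> verts_of G ` odds F)" for F
  define pick where "pick F = (SOME C. C \<in> odds F \<and> verts_of G C = X F)" for F
  define flip where "flip F = F - pick F \<union> bar (pick F)" for F
  let ?S = "{F. unbranched G F} - U_even G"
  have S_iff: "F \<in> ?S \<longleftrightarrow> unbranched G F \<and> odds F \<noteq> {}" for F
    by (auto simp: U_even_def odds_def)
  have pick: "pick F \<in> odds F" "verts_of G (pick F) = X F" if "odds F \<noteq> {}" for F
  proof -
    have "X F \<in> verts_of G ` odds F"
      unfolding X_def some_in_eq using that by simp
    then have "\<exists>C. C \<in> odds F \<and> verts_of G C = X F" by blast
    from someI_ex[OF this] show "pick F \<in> odds F" "verts_of G (pick F) = X F"
      by (simp_all add: pick_def)
  qed
  have pick_unique: "pick F = C" if "C \<in> odds F" "verts_of G C = X F" for F C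
  proof (rule ccontr)
    assume "pick F \<noteq> C"
    moreover have "pick F \<in> odds F" "verts_of G (pick F) = X F"
      using pick that by blast+
    \<comment> \<open>Distinct components have disjoint vertex sets, so equal vertex sets would have
      to be empty.\<close>
    ultimately have "verts_of G C = {}"
      using verts_disjoint_components[of F] that unfolding verts_disjoint_def odds_def by blast
    moreover have "C \<noteq> {}"
      using that(1) by (simp add: odds_def components_def)
    ultimately show False
      by (auto simp: verts_of_alt)
  qed
  have flip: "flip F \<in> ?S" "flip (flip F) = F" "prod g (flip F) = - prod g F"
    if F: "F \<in> ?S" for F
  proof -
    define C where "C = pick F"
    have F': "unbranched G F" "odds F \<noteq> {}"
      using F S_iff by blast+
    then have C: "C \<in> components G F" "odd (card C)" "verts_of G C = X F"
      using pick by (auto simp: C_def odds_def)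
    have CF: "C \<subseteq> F"
      using C(1) by (rule components_connected)
    have Cu: "C \<in> conn_unbranched G"
      using F' C(1) components_conn_unbranched by blast
    note barC = bar[OF Cu C(2)]
    have flip_eq: "flip F = F - C \<union> bar C"
      by (simp add: flip_def C_def)
    note repl = components_replace[OF F'(1) C(1), of "bar C", folded flip_eq]
    have odds_flip: "odds (flip F) = insert (bar C) (odds F - {C})"
      using repl(2) barC C by (auto simp: odds_def)
    have "C \<in> odds F"
      using C by (simp add: odds_def)
    \<comment> \<open>\<open>bar C\<close> replaces \<open>C\<close> among the odd components
      without changing the vertex set, so the selection rule finds \<open>bar C\<close> in
      \<open>flip F\<close>.\<close>
    then have "verts_of G ` odds (flip F) = verts_of G ` odds F"
      unfolding odds_flip using barC by (metis image_insert insert_Diff)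
    then have "X (flip F) = X F"
      by (simp add: X_def)
    then have pick_flip: "pick (flip F) = bar C"
      using odds_flip barC C by (intro pick_unique) auto
    show "flip F \<in> ?S"
      unfolding S_iff using repl(1) barC odds_flip by blast
    have disj: "(F - C) \<inter> bar C = {}"
      using repl(3) barC by blast
    have "flip (flip F) = flip F - bar C \<union> C"
      using pick_flip barC by (simp add: flip_def[of "flip F"])
    also have "\<dots> = F"
      using disj CF unfolding flip_eq by blast
    finally show "flip (flip F) = F" .
    have fin: "finite F"
      using F'(1) finite_subset[OF _ finite_arcs] by (auto simp: unbranched_def)
    have "prod g (flip F) = prod g (F - C) * prod g (bar C)"
      unfolding flip_eq using fin barC disj finite_conn_unbranched
      by (intro prod.union_disjoint) auto
    also have "\<dots> = - (prod g (F - C) * prod g C)"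
      using barC by simp
    also have "prod g (F - C) * prod g C = prod g F"
      using prod.subset_diff[OF CF fin, of g] by simp
    finally show "prod g (flip F) = - prod g F" .
  qed
  \<comment> \<open>Reindexing by the involution \<open>flip\<close> shows that the sum equals its
    own negative.\<close>
  have "(\<Sum>F\<in>?S. prod g F) = (\<Sum>F\<in>?S. - prod g F)"
    by (rule sum.reindex_bij_witness[of _ flip flip]) (use flip in auto)
  then show ?thesis
    by (simp add: sum_negf)
qed

lemma prod_components:
  assumes "unbranched G F"
  shows "prod g F = (\<Prod>C\<in>components G F. prod g C)"
proof -
  have "C \<inter> C' = {}" if "C \<in> components G F" "C' \<in> components G F" "C \<noteq> C'" for C C'
    using that verts_disjoint_components[of F] unfolding verts_disjoint_def
    by (intro verts_of_disjointD[of G]) simp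
  then have "prod g (\<Union> (components G F)) = (\<Prod>C\<in>components G F. prod g C)"
    using components_conn_unbranched[OF assms] finite_conn_unbranched
    by (subst prod.Union_disjoint) simp_all
  moreover have "\<Union> (components G F) = F"
    using assms Union_components by (simp add: unbranched_def)
  ultimately show ?thesis by simp
qed

text \<open>When no vertex is both a tail and a head in \<open>A\<close>, two arcs can meet only
  tail to tail or head to head, which is what unbranchedness forbids.\<close>

lemma matchings_endpoints:
  assumes "A \<subseteq> arcs G" "tail G ` A \<inter> head G ` A = {}"
  shows "matchings (endpoints G) A = {F. F \<subseteq> A \<and> unbranched G F}"
proof -
  have "(\<forall>e\<in>F. \<forall>f\<in>F. e \<noteq> f \<longrightarrow> endpoints G e \<inter> endpoints G f = {}) \<longleftrightarrow>
      unbranched G F" if "F \<subseteq> A" for F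
  proof -
    have "endpoints G e \<inter> endpoints G f = {} \<longleftrightarrow> tail G e \<noteq> tail G f \<and> head G e \<noteq> head G f"
      if "e \<in> F" "f \<in> F" for e f
    proof -
      have "tail G e \<noteq> head G f" "tail G f \<noteq> head G e"
        using that \<open>F \<subseteq> A\<close> assms(2) by blast+
      then show ?thesis by (auto simp: endpoints_def)
    qed
    moreover have "F \<subseteq> arcs G"
      using that assms(1) by blast
    ultimately show ?thesis
      unfolding unbranched_iff_inj inj_on_def by (simp cong: ball_cong) blast
  qed
  then show ?thesis
    unfolding matchings_def by (auto simp only: cong: conj_cong)
qed

end

section \<open>Bipartite graphs\<close>

locale bipartite_oriented_graph = oriented_graph D
  for D :: "('a, 'b) pre_digraph" +
  fixes V1 V2 :: "'a set"
  assumes bipartite: "bipartite_wrt D V1 V2"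
begin

definition forward :: "'b set \<Rightarrow> 'b set" where
  "forward F = {e\<in>F. tail D e \<in> V1}"

text \<open>For arcs of \<open>D\<close> the tail is then in \<open>V2\<close>; the negation makes
  \<open>forward\<close> and \<open>backward\<close> complementary on any set of arcs.\<close>

definition backward :: "'b set \<Rightarrow> 'b set" where
  "backward F = {e\<in>F. tail D e \<notin> V1}"

lemma tail_in_V1_iff: "e \<in> arcs D \<Longrightarrow> tail D e \<in> V1 \<longleftrightarrow> head D e \<notin> V1"
  using bipartite unfolding bipartite_wrt_def by blast

text \<open>Forward arcs are counted by their tails and backward arcs by their heads, so both counts
  refer to vertices of \<open>V1\<close>.\<close>

lemma card_forward_backward:
  assumes "C \<in> conn_unbranched D"
  shows "card C = card (forward C) + card (backward C)"
    "card (forward C) = card (tail D ` C \<inter> V1)"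
    "card (backward C) = card (head D ` C \<inter> V1)"
proof -
  have sub: "C \<subseteq> arcs D" and inj: "inj_on (tail D) C" "inj_on (head D) C"
    using assms by (auto simp: conn_unbranched_def unbranched_iff_inj)
  have "finite C"
    using assms by (rule finite_conn_unbranched)
  then have "card (forward C \<union> backward C) = card (forward C) + card (backward C)"
    by (intro card_Un_disjoint) (auto simp: forward_def backward_def)
  moreover have "forward C \<union> backward C = C"
    by (auto simp: forward_def backward_def)
  ultimately show "card C = card (forward C) + card (backward C)"
    by simp
  have "tail D ` C \<inter> V1 = tail D ` forward C"
    by (auto simp: forward_def)
  moreover have "inj_on (tail D) (forward C)"
    using inj(1) by (rule inj_on_subset) (auto simp: forward_def)
  ultimately show "card (forward C) = card (tail D ` C \<inter> V1)"
    by (simp add: card_image)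
  have "head D ` C \<inter> V1 = head D ` backward C"
    using sub by (auto simp: backward_def tail_in_V1_iff)
  moreover have "inj_on (head D) (backward C)"
    using inj(2) by (rule inj_on_subset) (auto simp: backward_def)
  ultimately show "card (backward C) = card (head D ` C \<inter> V1)"
    by (simp add: card_image)
qed

lemma loop_balanced:
  assumes "loop_subgraph D C"
  shows "card (forward C) = card (backward C)"
proof -
  have C: "C \<in> conn_unbranched D"
    using assms by (simp add: loop_subgraph_def)
  show ?thesis
    using assms card_forward_backward(2,3)[OF C] loop_subgraph_iff[OF C] by simp
qed

text \<open>On a path, each of the two images misses at most one vertex of \<open>V1\<close>, so the
  two counts differ by at most one; an even total forces equality.\<close>

lemma even_balanced:
  assumes C: "C \<in> conn_unbranched D" and even: "even (card C)"
  shows "card (forward C) = card (backward C)"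
proof (cases "loop_subgraph D C")
  case False
  from path_ends[OF C this] obtain x y where
    ends: "initial_vertex D C x" "final_vertex D C y"
      "tail D ` C = verts_of D C - {y}" "head D ` C = verts_of D C - {x}" .
  let ?W = "verts_of D C \<inter> V1"
  have "finite ?W"
    using finite_conn_unbranched[OF C] by (simp add: verts_of_alt)
  moreover have "tail D ` C \<inter> V1 = ?W - {y}" "head D ` C \<inter> V1 = ?W - {x}"
    using ends by blast+
  ultimately have "card (forward C) \<in> {card ?W, card ?W - 1}"
      "card (backward C) \<in> {card ?W, card ?W - 1}"
    using card_forward_backward(2,3)[OF C] by (simp_all add: card_Diff_singleton_if)
  moreover have "even (card (forward C) + card (backward C))"
    using even card_forward_backward(1)[OF C] by simp
  \<comment> \<open>If \<open>card ?W\<close> is 0, truncated subtraction makes both counts 0;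
    otherwise the two candidates have different parity.\<close>
  ultimately show ?thesis
    by (cases "card ?W") auto
qed (rule loop_balanced)

text \<open>The final vertex of \<open>C'\<close> is the initial one of \<open>C\<close> and
  conversely, so the images of \<open>tail\<close> and \<open>head\<close> are exchanged, and with
  them the counts.\<close>

lemma reverse_path_forward_backward:
  assumes C: "C \<in> conn_unbranched D" "\<not> loop_subgraph D C"
    and C': "C' \<in> conn_unbranched D" "\<not> loop_subgraph D C'"
    and same_verts: "verts_of D C' = verts_of D C"
    and swap: "\<And>x y. initial_vertex D C x \<Longrightarrow> final_vertex D C y \<Longrightarrow>
      initial_vertex D C' y \<and> final_vertex D C' x"
  shows "card (forward C') = card (backward C)" "card (backward C') = card (forward C)"
proof -
  from path_ends[OF C] obtain x y where
    ends: "initial_vertex D C x" "final_vertex D C y"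
      "tail D ` C = verts_of D C - {y}" "head D ` C = verts_of D C - {x}" .
  from path_ends[OF C'] obtain x' y' where
    ends': "initial_vertex D C' x'" "final_vertex D C' y'"
      "tail D ` C' = verts_of D C' - {y'}" "head D ` C' = verts_of D C' - {x'}" .
  have "initial_vertex D C' y" "final_vertex D C' x"
    using swap ends by blast+
  then have "y \<in> verts_of D C' - head D ` C'" "x \<in> verts_of D C' - tail D ` C'"
    by (simp_all only: initial_vertex_image final_vertex_image)
  then have "x' = y" "y' = x"
    using ends' by simp_all
  then have "tail D ` C' = head D ` C" "head D ` C' = tail D ` C"
    using ends ends' same_verts by auto
  then show "card (forward C') = card (backward C)" "card (backward C') = card (forward C)"
    using card_forward_backward(2,3)[OF C(1)] card_forward_backward(2,3)[OF C'(1)] by simp_all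
qed

section \<open>Weights and the factorization into two matching sums\<close>

lemma prod_weight:
  fixes a b :: complex
  assumes "finite F"
  shows "(\<Prod>e\<in>F. if tail D e \<in> V1 then a else b) = a ^ card (forward F) * b ^ card (backward F)"
  using assms by (simp add: prod.If_cases forward_def backward_def Int_def)

text \<open>A forward and a backward arc have tails in different classes and heads in different
  classes, so they never violate unbranchedness together. Hence \<open>F\<close> corresponds to an
  arbitrary pair of matchings, one in each direction.\<close>

lemma unbranched_sum_factor:
  "(\<Sum>F\<in>{F. unbranched D F}. \<Prod>e\<in>F. if tail D e \<in> V1 then a else b) =
    matching_sum (endpoints D) a (forward (arcs D)) *
    matching_sum (endpoints D) b (backward (arcs D))"
proof -
  let ?A = "forward (arcs D)" and ?B = "backward (arcs D)"
  have m: "matchings (endpoints D) ?A = {F. F \<subseteq> ?A \<and> unbranched D F}"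
      "matchings (endpoints D) ?B = {F. F \<subseteq> ?B \<and> unbranched D F}"
    by (rule matchings_endpoints; auto simp: forward_def backward_def tail_in_V1_iff)+
  have un: "unbranched D (F \<union> H)"
    if "F \<subseteq> ?A" "unbranched D F" "H \<subseteq> ?B" "unbranched D H" for F H
  proof -
    have "tail D e \<noteq> tail D f \<and> head D e \<noteq> head D f" if "e \<in> F" "f \<in> H" for e f
    proof -
      have "e \<in> arcs D" "f \<in> arcs D" "tail D e \<in> V1" "tail D f \<notin> V1"
        using that \<open>F \<subseteq> ?A\<close> \<open>H \<subseteq> ?B\<close> by (auto simp: forward_def backward_def)
      then show ?thesis
        using tail_in_V1_iff by metis
    qed
    then have "tail D ` (F - H) \<inter> tail D ` (H - F) = {}" "head D ` (F - H) \<inter> head D ` (H - F) = {}"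
      by blast+
    then show ?thesis
      using that(2,4) by (simp add: unbranched_iff_inj inj_on_Un)
  qed
  have split: "forward (F \<union> H) = F" "backward (F \<union> H) = H" if "F \<subseteq> ?A" "H \<subseteq> ?B" for F H
    using that by (auto simp: forward_def backward_def)
  have join: "forward F \<union> backward F = F" for F
    by (auto simp: forward_def backward_def)
  have sub: "forward F \<subseteq> F" "backward F \<subseteq> F" for F
    by (auto simp: forward_def backward_def)
  have "(\<Sum>F\<in>{F. unbranched D F}. \<Prod>e\<in>F. if tail D e \<in> V1 then a else b) =
      (\<Sum>F\<in>{F. unbranched D F}. a ^ card (forward F) * b ^ card (backward F))"
    using finite_subset[OF _ finite_arcs]
    by (intro sum.cong refl prod_weight) (auto simp: unbranched_def)
  also have "\<dots> = (\<Sum>(F, H)\<in>matchings (endpoints D) ?A \<times> matchings (endpoints D) ?B.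
      a ^ card F * b ^ card H)"
    unfolding m
  proof (rule sum.reindex_bij_witness[of _ "\<lambda>(F, H). F \<union> H" "\<lambda>F. (forward F, backward F)"])
    fix F assume F: "F \<in> {F. unbranched D F}"
    then have "F \<subseteq> arcs D" by (simp add: unbranched_def)
    then have "forward F \<subseteq> ?A" "backward F \<subseteq> ?B"
      by (auto simp: forward_def backward_def)
    then show "(forward F, backward F) \<in>
        {F. F \<subseteq> ?A \<and> unbranched D F} \<times> {F. F \<subseteq> ?B \<and> unbranched D F}"
      using F sub unbranched_subset by simp
  qed (use un split join in auto)
  also have "\<dots> = matching_sum (endpoints D) a ?A * matching_sum (endpoints D) b ?B"
    by (simp add: matching_sum_def sum_product sum.cartesian_product)
  finally show ?thesis .
qed

text \<open>With \<open>c = \<i> z\<close>, a component with \<open>k\<close> arcs in each direction has weight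
  \<open>(- c)\<^sup>k c\<^sup>k = z\<^sup>2\<^sup>k\<close>.\<close>
lemma even_sum_weight:
  "poly (p_unbranched_even D) z =
    (\<Sum>F\<in>U_even D. \<Prod>e\<in>F. if tail D e \<in> V1 then - (\<i> * z) else \<i> * z)"
proof -
  let ?g = "\<lambda>e. if tail D e \<in> V1 then - (\<i> * z) else \<i> * z"
  \<comment> \<open>The power of \<open>z\<close> is written as a product over arcs so that
    \<open>prod_components\<close> also applies to the constant weight.\<close>
  have comp: "prod ?g C = (\<Prod>e\<in>C. z)" if C: "C \<in> conn_unbranched D" "even (card C)" for C
  proof -
    let ?k = "card (backward C)"
    have bal: "card (forward C) = ?k"
      using even_balanced[OF C] .
    have "prod ?g C = (- (\<i> * z)) ^ ?k * (\<i> * z) ^ ?k"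
      using prod_weight[OF finite_conn_unbranched[OF C(1)]] bal by simp
    also have "\<dots> = (z * z) ^ ?k"
      unfolding power_mult_distrib[symmetric] by (simp add: algebra_simps)
    also have "\<dots> = z ^ card C"
      using card_forward_backward(1)[OF C(1)] bal by (simp add: power_mult_distrib power_add)
    finally show ?thesis by simp
  qed
  have "z ^ card F = prod ?g F" if F: "F \<in> U_even D" for F
  proof -
    have u: "unbranched D F" "\<And>C. C \<in> components D F \<Longrightarrow> even (card C)"
      using F by (auto simp: U_even_def)
    have "prod ?g F = (\<Prod>C\<in>components D F. \<Prod>e\<in>C. z)"
      unfolding prod_components[OF u(1), of ?g]
    proof (rule prod.cong)
      fix C assume "C \<in> components D F"
      then show "prod ?g C = (\<Prod>e\<in>C. z)"
        using u components_conn_unbranched comp by blast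
    qed simp
    also have "\<dots> = (\<Prod>e\<in>F. z)"
      using prod_components[OF u(1), of "\<lambda>_. z"] by simp
    finally show ?thesis by simp
  qed
  then show ?thesis
    by (simp add: p_unbranched_even_def poly_sum poly_monom)
qed

end

theorem mainTheorem2:
  fixes D :: "('a, 'b) pre_digraph"
    and V1 V2 :: "'a set"
    and bar :: "'b set \<Rightarrow> 'b set"
    and z :: complex
  assumes graph: "oriented_graph D"
    and bipartite: "bipartite_wrt D V1 V2"
    and bar_maps: "\<And>G. G \<in> conn_unbranched D \<Longrightarrow> bar G \<in> conn_unbranched D"
    and bar_involution: "\<And>G. G \<in> conn_unbranched D \<Longrightarrow> bar (bar G) = G"
    and same_vertices: "\<And>G. G \<in> conn_unbranched D \<Longrightarrow>
          (\<Union>e \<in> bar G. endpoints D e) = (\<Union>e \<in> G. endpoints D e)"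
    and same_kind: "\<And>G. G \<in> conn_unbranched D \<Longrightarrow>
          loop_subgraph D (bar G) \<longleftrightarrow> loop_subgraph D G"
    and swaps_ends: "\<And>G x' x''. G \<in> conn_unbranched D \<Longrightarrow> \<not> loop_subgraph D G \<Longrightarrow>
          initial_vertex D G x' \<Longrightarrow> final_vertex D G x'' \<Longrightarrow>
          initial_vertex D (bar G) x'' \<and> final_vertex D (bar G) x'"
    and root: "poly (p_unbranched_even D) z = 0"
  shows "Re z = 0"
proof -
  interpret oriented_graph D by (rule graph)
  interpret bipartite_oriented_graph D V1 V2
    by unfold_locales (rule bipartite)
  let ?c = "\<i> * z"
  let ?g = "\<lambda>e. if tail D e \<in> V1 then - ?c else ?c"
  have bar: "bar C \<in> conn_unbranched D \<and> bar (bar C) = C \<and> verts_of D (bar C) = verts_of D C \<and>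
      card (bar C) = card C \<and> prod ?g (bar C) = - prod ?g C"
    if C: "C \<in> conn_unbranched D" and odd: "odd (card C)" for C
  proof -
    note C' = bar_maps[OF C]
    \<comment> \<open>Loops are balanced and hence of even length, so an odd \<open>C\<close> is a
      path and its partner swaps the ends.\<close>
    have not_loop: "\<not> loop_subgraph D C"
      using loop_balanced odd card_forward_backward(1)[OF C] by auto
    have not_loop': "\<not> loop_subgraph D (bar C)"
      using not_loop same_kind[OF C] by simp
    have verts: "verts_of D (bar C) = verts_of D C"
      using same_vertices[OF C] by (simp add: verts_of_def)
    have cards: "card (forward (bar C)) = card (backward C)" "card (backward (bar C)) = card (forward C)"
      by (rule reverse_path_forward_backward[OF C not_loop C' not_loop' verts];
          rule swaps_ends[OF C not_loop]; assumption)+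
    have card: "card (bar C) = card C"
      using cards card_forward_backward(1)[OF C] card_forward_backward(1)[OF C'] by simp
    let ?a = "card (forward C)" and ?b = "card (backward C)"
    have "odd (?a + ?b)"
      using odd card_forward_backward(1)[OF C] by simp
    \<comment> \<open>Exactly one of \<open>?a\<close> and \<open>?b\<close> is odd, so moving the
      minus sign to the other exponent changes the sign of the product.\<close>
    then have "(- ?c) ^ ?b * ?c ^ ?a = - ((- ?c) ^ ?a * ?c ^ ?b)"
      by (cases "even ?a") (auto simp: mult.commute)
    then have "prod ?g (bar C) = - prod ?g C"
      unfolding prod_weight[OF finite_conn_unbranched[OF C]]
        prod_weight[OF finite_conn_unbranched[OF C']] cards .
    then show ?thesis
      using C' bar_involution[OF C] verts card by blast
  qed
  have "(\<Sum>F\<in>{F. unbranched D F}. prod ?g F) =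
      (\<Sum>F\<in>{F. unbranched D F} - U_even D. prod ?g F) + (\<Sum>F\<in>U_even D. prod ?g F)"
    using finite_unbranched by (intro sum.subset_diff) (auto simp: U_even_def)
  also have "\<dots> = 0"
    using odd_terms_cancel[of bar ?g, OF bar] even_sum_weight[of z] root by simp
  finally have "matching_sum (endpoints D) (- ?c) (forward (arcs D)) = 0 \<or>
      matching_sum (endpoints D) ?c (backward (arcs D)) = 0"
    unfolding unbranched_sum_factor by simp
  moreover have "card (endpoints D e) = 2" if "e \<in> arcs D" for e
    using no_loops[OF that] by (simp add: endpoints_def)
  moreover have "finite (forward (arcs D))" "finite (backward (arcs D))"
      "forward (arcs D) \<subseteq> arcs D" "backward (arcs D) \<subseteq> arcs D"
    by (auto simp: forward_def backward_def)
  \<comment> \<open>Whichever factor vanishes, \<open>\<i> * z\<close> is real, and its imaginary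
    part is \<open>Re z\<close>.\<close>
  ultimately have "- ?c \<in> \<real> \<or> ?c \<in> \<real>"
    using Heilmann_Lieb by (metis subsetD)
  then show ?thesis
    by (auto simp: complex_is_Real_iff)
qed

end
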